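(* Let $R$ be a Lie conformal superalgebra and $Z(R)$ the center of $R$. Then $[\mathrm{C}(R)_\lambda\mathrm{QC}(R)]\subseteq\mathrm{Chom}(R,Z(R))[\lambda]$, that is, $[f_\lambda g]\in\mathrm{Chom}(R,Z(R))[\lambda]$ for all $f\in\mathrm{C}(R)$, $g\in\mathrm{QC}(R)$. Moreover, if $Z(R)=0$, then $[\mathrm{C}(R)_\lambda\mathrm{QC}(R)]=0$.
   Context: Everything is over $\mathbb{C}$. Degrees $|a|$ lie in $\mathbb{Z}_2$; whenever $|a|$ occurs, $a$ is homogeneous, and formulas are extended linearly. All $\mathbb{Z}_2$-graded $\mathbb{C}[\partial]$-modules are finitely generated. A Lie conformal superalgebra is a $\mathbb{Z}_2$-graded $\mathbb{C}[\partial]$-module $R=R_{\bar0}\oplus R_{\bar1}$ with a $\mathbb{C}$-bilinear map $R\times R\to R[\lambda]$, $(a,b)\mapsto[a_\lambda b]$, compatible with the grading, such that (C1) $[(\partial a)_\lambda b]=-\lambda[a_\lambda b]$; (C2) $[a_\lambda b]=-(-1)^{|a||b|}[b_{-\partial-\lambda}a]$ (on the right, $\nu=-\partial-\lambda$ is substituted into $[b_\nu a]=\sum_n\nu^nc_n$ with $\partial$ acting on the $c_n$); (C3) $[a_\lambda[b_\mu c]]=[[a_\lambda b]_{\lambda+\mu}c]+(-1)^{|a||b|}[b_\mu[a_\lambda c]]$. Brackets and maps are extended linearly over polynomials in the formal variables. The center is $Z(R)=\{a\in R:[a_\lambda b]=0\ \forall b\in R\}$. A conformal linear map of degree $\theta$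 from $M$ to $N$ is a $\mathbb{C}$-linear $f_\lambda:M\to N[\lambda]$ with $f_\lambda\partial=(\partial+\lambda)f_\lambda$ and $f_\lambda(M_\mu)\subseteq N_{\mu+\theta}[\lambda]$; $\mathrm{Chom}(M,N)$ is the sum of the spaces of those of degree $\bar0$ and $\bar1$, and $\mathrm{Cend}(R)=\mathrm{Chom}(R,R)$. $\mathrm{Cend}(R)$ is a Lie conformal superalgebra with $(\partial f)_\lambda=-\lambda f_\lambda$ and $[f_\lambda g]_\mu=f_\lambda g_{\mu-\lambda}-(-1)^{|f||g|}g_{\mu-\lambda}f_\lambda$. For $f\in\mathrm{Cend}(R)_\theta$: - $f\in\mathrm{C}(R)_\theta$ (centroid) if $[(f_\lambda(a))_{\lambda+\mu}b]=(-1)^{\theta|a|}[a_\mu(f_\lambda(b))]=f_\lambda([a_\mu b])$ for all $a,b\in R$; - $f\in\mathrm{QC}(R)_\theta$ (quasicentroid) if $[(f_\lambda(a))_{\lambda+\mu}b]=(-1)^{\theta|a|}[a_\mu(f_\lambda(b))]$ for all $a,b\in R$. $\mathrm{C}(R)$, $\mathrm{QC}(R)$ denote the sums of their degree $\bar0$ and degree $\bar1$ parts. *)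

theory Defs
  imports Complex_Main "HOL-Computational_Algebra.Polynomial" "HOL-Library.Z2"
    "HOL-Library.Function_Algebras"
begin

text \<open>
  For an abelian group \<open>R\<close>, the group \<open>R[\<lambda>]\<close> is the type \<open>'r poly\<close>, and \<open>R[\<lambda>,\<mu>]\<close> is the type
  \<open>'r poly poly\<close>, where the outer variable is \<open>\<lambda>\<close> and the inner one is \<open>\<mu>\<close>.
  A formal expression to be substituted for a variable (such as \<open>\<lambda> + \<mu>\<close>, \<open>\<mu> - \<lambda>\<close> or
  \<open>- \<partial> - \<lambda>\<close>) is represented by the additive operator it induces on the target group.
\<close>

text \<open>\<open>subst T \<iota> (\<Sum>n. \<nu>^n c\<^sub>n) = \<Sum>n. T^n (\<iota> c\<^sub>n)\<close>\<close>

definition subst :: "('p \<Rightarrow> 'p) \<Rightarrow> ('r \<Rightarrow> 'p) \<Rightarrow> 'r::zero poly \<Rightarrow> 'p::comm_monoid_add" where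
  "subst T \<iota> p = (\<Sum>n\<le>degree p. (T ^^ n) (\<iota> (coeff p n)))"

definition lam :: "'r::ab_group_add poly poly \<Rightarrow> 'r poly poly" where
  "lam P = pCons 0 P"

definition mu :: "'r::ab_group_add poly poly \<Rightarrow> 'r poly poly" where
  "mu P = map_poly (pCons 0) P"

text \<open>\<open>at_var V p\<close> is \<open>p(V) \<in> R[\<lambda>,\<mu>]\<close> for \<open>p \<in> R[\<nu>]\<close>.\<close>

definition at_var ::
  "('r::ab_group_add poly poly \<Rightarrow> 'r poly poly) \<Rightarrow> 'r poly \<Rightarrow> 'r poly poly" where
  "at_var V p = subst V (\<lambda>c. [:[:c:]:]) p"

text \<open>
  \<open>apply_at V F W p\<close> is \<open>\<Sum>n. W^n F\<^sub>V(c\<^sub>n)\<close> for \<open>p = \<Sum>n. \<nu>^n c\<^sub>n\<close>, that is, \<open>F\<^sub>V(p(W))\<close> where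
  \<open>F\<^sub>\<nu> : R \<rightarrow> R[\<nu>]\<close> is extended linearly over polynomials in the formal variables.
\<close>

definition apply_at ::
  "('r::ab_group_add poly poly \<Rightarrow> 'r poly poly) \<Rightarrow> ('r \<Rightarrow> 'r poly)
    \<Rightarrow> ('r poly poly \<Rightarrow> 'r poly poly) \<Rightarrow> 'r poly \<Rightarrow> 'r poly poly" where
  "apply_at V F W p = subst W (\<lambda>c. at_var V (F c)) p"

text \<open>Polynomials in \<open>\<lambda>\<close> with coefficients in \<open>S\<close>, given by their sequences of coefficients.\<close>

definition polys_over :: "'x::zero set \<Rightarrow> (nat \<Rightarrow> 'x) set" where
  "polys_over S = {h. (\<forall>n. h n \<in> S) \<and> (\<forall>\<^sub>\<infinity>n. h n = 0)}"

text \<open>\<open>super_sign k x = (-1)^k x\<close>\<close>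

definition super_sign :: "bit \<Rightarrow> 'x::ab_group_add \<Rightarrow> 'x" where
  "super_sign k x = (if k = 0 then x else - x)"

definition graded_sum :: "(bit \<Rightarrow> 'x::plus set) \<Rightarrow> 'x set" where
  "graded_sum G = {x + y | x y. x \<in> G 0 \<and> y \<in> G 1}"

text \<open>The degree \<open>i\<close> component of \<open>x\<close>; meaningful if \<open>x\<close> is in the direct sum of \<open>G 0\<close> and \<open>G 1\<close>.\<close>

definition component :: "(bit \<Rightarrow> 'x::plus set) \<Rightarrow> bit \<Rightarrow> 'x \<Rightarrow> 'x" where
  "component G i x = (THE d. (\<forall>j. d j \<in> G j) \<and> x = d 0 + d 1) i"

text \<open>A \<open>\<complex>[\<partial>]\<close>-module is a module over \<^typ>\<open>complex poly\<close>; \<open>\<partial>\<close> acts as the variable \<open>[:0, 1:]\<close>.\<close>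

definition del :: "(complex poly \<Rightarrow> 'r \<Rightarrow> 'r) \<Rightarrow> 'r \<Rightarrow> 'r" where
  "del scale a = scale [:0, 1:] a"

locale graded_module = module scale
  for scale :: "complex poly \<Rightarrow> 'r::ab_group_add \<Rightarrow> 'r" +
  fixes R :: "bit \<Rightarrow> 'r set"
  assumes finitely_generated: "\<exists>S. finite S \<and> span S = UNIV"
    and subspace_R: "subspace (R i)"
    and R_sum: "graded_sum R = UNIV"
    and R_Int: "R 0 \<inter> R 1 = {0}"

definition clinear_poly ::
  "(complex poly \<Rightarrow> 'm::ab_group_add \<Rightarrow> 'm) \<Rightarrow> (complex poly \<Rightarrow> 'n::ab_group_add \<Rightarrow> 'n)
    \<Rightarrow> ('m \<Rightarrow> 'n poly) \<Rightarrow> bool" where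
  "clinear_poly sM sN f \<longleftrightarrow>
     Vector_Spaces.linear (\<lambda>c. sM [:c:]) (\<lambda>c. map_poly (sN [:c:])) f"

locale lie_conformal_superalgebra = graded_module scale R
  for scale :: "complex poly \<Rightarrow> 'r::ab_group_add \<Rightarrow> 'r" and R :: "bit \<Rightarrow> 'r set" +
  fixes br :: "'r \<Rightarrow> 'r \<Rightarrow> 'r poly"
  assumes linear_right: "clinear_poly scale scale (\<lambda>b. br a b)"
    and linear_left: "clinear_poly scale scale (\<lambda>a. br a b)"
    and br_grading: "\<lbrakk>a \<in> R i; b \<in> R j\<rbrakk> \<Longrightarrow> coeff (br a b) n \<in> R (i + j)"
    and C1: "br (del scale a) b = - pCons 0 (br a b)"
    and C2: "\<lbrakk>a \<in> R i; b \<in> R j\<rbrakk> \<Longrightarrow>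
      br a b = - super_sign (i * j)
        (subst (\<lambda>p. - map_poly (del scale) p - pCons 0 p) (\<lambda>c. [:c:]) (br b a))"
    and C3: "\<lbrakk>a \<in> R i; b \<in> R j\<rbrakk> \<Longrightarrow>
      apply_at lam (\<lambda>d. br a d) mu (br b c) =
        apply_at (lam + mu) (\<lambda>d. br d c) lam (br a b)
        + super_sign (i * j) (apply_at mu (\<lambda>d. br b d) lam (br a c))"

definition center :: "('r \<Rightarrow> 'r \<Rightarrow> 'r::ab_group_add poly) \<Rightarrow> 'r set" where
  "center br = {a. \<forall>b. br a b = 0}"

text \<open>
  The target is a graded submodule \<open>N 0 + N 1\<close> of the type \<open>'n\<close>, so that it can be the center.
\<close>

definition Chom_deg ::
  "(complex poly \<Rightarrow> 'm::ab_group_add \<Rightarrow> 'm) \<Rightarrow> (bit \<Rightarrow> 'm set)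
    \<Rightarrow> (complex poly \<Rightarrow> 'n::ab_group_add \<Rightarrow> 'n) \<Rightarrow> (bit \<Rightarrow> 'n set)
    \<Rightarrow> bit \<Rightarrow> ('m \<Rightarrow> 'n poly) set" where
  "Chom_deg sM M sN N \<theta> = {f.
     clinear_poly sM sN f
     \<and> (\<forall>a. f (del sM a) = map_poly (del sN) (f a) + pCons 0 (f a))
     \<and> (\<forall>i. \<forall>a\<in>M i. \<forall>n. coeff (f a) n \<in> N (i + \<theta>))}"

definition Chom ::
  "(complex poly \<Rightarrow> 'm::ab_group_add \<Rightarrow> 'm) \<Rightarrow> (bit \<Rightarrow> 'm set)
    \<Rightarrow> (complex poly \<Rightarrow> 'n::ab_group_add \<Rightarrow> 'n) \<Rightarrow> (bit \<Rightarrow> 'n set)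
    \<Rightarrow> ('m \<Rightarrow> 'n poly) set" where
  "Chom sM M sN N = graded_sum (Chom_deg sM M sN N)"

abbreviation Cend_deg ::
  "(complex poly \<Rightarrow> 'r::ab_group_add \<Rightarrow> 'r) \<Rightarrow> (bit \<Rightarrow> 'r set) \<Rightarrow> bit \<Rightarrow> ('r \<Rightarrow> 'r poly) set" where
  "Cend_deg scale R \<equiv> Chom_deg scale R scale R"

text \<open>
  \<open>[f\<^sub>\<lambda> g]\<^sub>\<mu>(a) = f\<^sub>\<lambda>(g\<^sub>\<mu>\<^sub>-\<^sub>\<lambda>(a)) - (-1)^(i j) g\<^sub>\<mu>\<^sub>-\<^sub>\<lambda>(f\<^sub>\<lambda>(a)) \<in> R[\<lambda>,\<mu>]\<close> for \<open>f\<close>, \<open>g\<close> of degrees \<open>i\<close>, \<open>j\<close>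
\<close>

definition Cend_bracket_hom ::
  "bit \<Rightarrow> bit \<Rightarrow> ('r::ab_group_add \<Rightarrow> 'r poly) \<Rightarrow> ('r \<Rightarrow> 'r poly) \<Rightarrow> 'r \<Rightarrow> 'r poly poly" where
  "Cend_bracket_hom i j f g a =
     apply_at lam f (mu - lam) (g a) - super_sign (i * j) (apply_at (mu - lam) g lam (f a))"

text \<open>
  The bilinear extension to all of \<open>Cend(R)\<close>. The value \<open>[f\<^sub>\<lambda> g]\<close> is given by its sequence of
  coefficients in \<open>\<lambda>\<close>; the \<open>n\<close>-th one is the map sending \<open>a\<close> to the coefficient of \<open>\<lambda>^n\<close>
  in \<open>[f\<^sub>\<lambda> g]\<^sub>\<mu>(a)\<close>, which is a polynomial in \<open>\<mu>\<close>. That only finitely many coefficients are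
  nonzero is not built in, but is part of membership in \<^const>\<open>polys_over\<close>.
\<close>

definition Cend_bracket ::
  "(complex poly \<Rightarrow> 'r::ab_group_add \<Rightarrow> 'r) \<Rightarrow> (bit \<Rightarrow> 'r set)
    \<Rightarrow> ('r \<Rightarrow> 'r poly) \<Rightarrow> ('r \<Rightarrow> 'r poly) \<Rightarrow> nat \<Rightarrow> ('r \<Rightarrow> 'r poly)" where
  "Cend_bracket scale R f g n = (\<lambda>a. \<Sum>i\<in>{0, 1}. \<Sum>j\<in>{0, 1}.
     coeff (Cend_bracket_hom i j
       (component (Cend_deg scale R) i f) (component (Cend_deg scale R) j g) a) n)"

definition centroid_deg ::
  "(complex poly \<Rightarrow> 'r::ab_group_add \<Rightarrow> 'r) \<Rightarrow> (bit \<Rightarrow> 'r set) \<Rightarrow> ('r \<Rightarrow> 'r \<Rightarrow> 'r poly)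
    \<Rightarrow> bit \<Rightarrow> ('r \<Rightarrow> 'r poly) set" where
  "centroid_deg scale R br \<theta> = {f \<in> Cend_deg scale R \<theta>. \<forall>i. \<forall>a\<in>R i. \<forall>b.
     apply_at (lam + mu) (\<lambda>d. br d b) lam (f a)
       = super_sign (\<theta> * i) (apply_at mu (\<lambda>d. br a d) lam (f b))
     \<and> super_sign (\<theta> * i) (apply_at mu (\<lambda>d. br a d) lam (f b))
       = apply_at lam f mu (br a b)}"

definition quasicentroid_deg ::
  "(complex poly \<Rightarrow> 'r::ab_group_add \<Rightarrow> 'r) \<Rightarrow> (bit \<Rightarrow> 'r set) \<Rightarrow> ('r \<Rightarrow> 'r \<Rightarrow> 'r poly)
    \<Rightarrow> bit \<Rightarrow> ('r \<Rightarrow> 'r poly) set" where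
  "quasicentroid_deg scale R br \<theta> = {f \<in> Cend_deg scale R \<theta>. \<forall>i. \<forall>a\<in>R i. \<forall>b.
     apply_at (lam + mu) (\<lambda>d. br d b) lam (f a)
       = super_sign (\<theta> * i) (apply_at mu (\<lambda>d. br a d) lam (f b))}"

definition centroid ::
  "(complex poly \<Rightarrow> 'r::ab_group_add \<Rightarrow> 'r) \<Rightarrow> (bit \<Rightarrow> 'r set) \<Rightarrow> ('r \<Rightarrow> 'r \<Rightarrow> 'r poly)
    \<Rightarrow> ('r \<Rightarrow> 'r poly) set" where
  "centroid scale R br = graded_sum (centroid_deg scale R br)"

definition quasicentroid ::
  "(complex poly \<Rightarrow> 'r::ab_group_add \<Rightarrow> 'r) \<Rightarrow> (bit \<Rightarrow> 'r set) \<Rightarrow> ('r \<Rightarrow> 'r \<Rightarrow> 'r poly)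
    \<Rightarrow> ('r \<Rightarrow> 'r poly) set" where
  "quasicentroid scale R br = graded_sum (quasicentroid_deg scale R br)"

end

theory Submission
  imports Defs
begin

text \<open>
  Since \<open>\<complex>\<close> is infinite, a polynomial with coefficients in a complex vector space is determined by
  its values, so the formal variables may be replaced by complex numbers. For \<open>f\<close> in the centroid
  and \<open>g\<close> in the quasicentroid, of degrees \<open>i\<close> and \<open>j\<close>, and \<open>a\<close> of degree \<open>k\<close>,
  \<open>[f\<^sub>x(g\<^sub>y a)\<^sub>x\<^sub>+\<^sub>y\<^sub>+\<^sub>z b] = f\<^sub>x[(g\<^sub>y a)\<^sub>y\<^sub>+\<^sub>z b] = (-1)^(j k) f\<^sub>x[a\<^sub>z g\<^sub>y b] = (-1)^(j k) [(f\<^sub>x a)\<^sub>x\<^sub>+\<^sub>z g\<^sub>y b]\<close>,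
  which is \<open>(-1)^(i j) [g\<^sub>y(f\<^sub>x a)\<^sub>x\<^sub>+\<^sub>y\<^sub>+\<^sub>z b]\<close>. Hence the values of the commutator, and with them its
  coefficients, are central.
\<close>

section \<open>Evaluation of polynomials with vector coefficients\<close>

locale poly_space = vector_space scl
  for scl :: "'k::field_char_0 \<Rightarrow> 'r::ab_group_add \<Rightarrow> 'r"
begin

text \<open>The argument is a scalar while the coefficients are vectors, so the powers of
  \<open>z\<close> act through \<open>scl\<close>.\<close>

definition ev :: "'k \<Rightarrow> 'r poly \<Rightarrow> 'r" where
  "ev z p = (\<Sum>n\<le>degree p. scl (z ^ n) (coeff p n))"

text \<open>\<open>x\<close> is the value of the outer variable \<lambda> and \<open>y\<close> that
  of the inner variable \<mu>.\<close>

definition ev2 :: "'k \<Rightarrow> 'k \<Rightarrow> 'r poly poly \<Rightarrow> 'r" where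
  "ev2 x y P = (\<Sum>m\<le>degree P. scl (x ^ m) (ev y (coeff P m)))"

abbreviation linear_op :: "('r \<Rightarrow> 'r) \<Rightarrow> bool" where
  "linear_op \<equiv> Vector_Spaces.linear scl scl"

abbreviation linear_poly :: "('r \<Rightarrow> 'r poly) \<Rightarrow> bool" where
  "linear_poly \<equiv> Vector_Spaces.linear scl (\<lambda>c. map_poly (scl c))"

lemma linear_opI:
  assumes "\<And>a b. L (a + b) = L a + L b" "\<And>c a. L (scl c a) = scl c (L a)"
  shows "linear_op L"
  using assms vector_space_axioms
  by (simp add: Vector_Spaces.linear_def module_hom_def module_hom_axioms_def module_iff_vector_space)

lemma
  assumes "linear_op L"
  shows linear_op_add: "L (a + b) = L a + L b"
    and linear_op_scl: "L (scl c a) = scl c (L a)"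
    and linear_op_diff: "L (a - b) = L a - L b"
    and linear_op_0: "L 0 = 0"
    and linear_op_minus: "L (- a) = - L a"
    and linear_op_sum: "L (sum h A) = (\<Sum>n\<in>A. L (h n))"
proof -
  interpret L: Vector_Spaces.linear scl scl L by fact
  show "L (a + b) = L a + L b" "L (scl c a) = scl c (L a)" "L (a - b) = L a - L b"
    "L 0 = 0" "L (- a) = - L a" "L (sum h A) = (\<Sum>n\<in>A. L (h n))"
    by (simp_all add: L.add L.scale L.diff L.zero L.neg L.sum)
qed

lemma linear_op_super_sign: "linear_op L \<Longrightarrow> L (super_sign k a) = super_sign k (L a)"
  by (simp add: super_sign_def linear_op_minus)

lemma ev_eq_sum: "degree p \<le> N \<Longrightarrow> ev z p = (\<Sum>n\<le>N. scl (z ^ n) (coeff p n))"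
  unfolding ev_def by (rule sum.mono_neutral_left) (auto simp: coeff_eq_0)

lemma ev_0 [simp]: "ev z 0 = 0"
  by (simp add: ev_def)

lemma ev2_eq_sum: "degree P \<le> N \<Longrightarrow> ev2 x y P = (\<Sum>m\<le>N. scl (x ^ m) (ev y (coeff P m)))"
  unfolding ev2_def by (rule sum.mono_neutral_left) (auto simp: coeff_eq_0)

lemma ev_add: "ev z (p + q) = ev z p + ev z q"
proof -
  define N where "N = max (degree p) (degree q)"
  have "degree p \<le> N" "degree q \<le> N" "degree (p + q) \<le> N"
    by (auto simp: N_def degree_add_le)
  then show ?thesis
    by (simp add: ev_eq_sum scale_right_distrib sum.distrib)
qed

lemma ev2_add: "ev2 x y (P + Q) = ev2 x y P + ev2 x y Q"
proof -
  define N where "N = max (degree P) (degree Q)"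
  have "degree P \<le> N" "degree Q \<le> N" "degree (P + Q) \<le> N"
    by (auto simp: N_def degree_add_le)
  then show ?thesis
    by (simp add: ev2_eq_sum ev_add scale_right_distrib sum.distrib)
qed

lemma ev2_0 [simp]: "ev2 x y 0 = 0"
  by (simp add: ev2_def)

lemma ev2_minus: "ev2 x y (- P) = - ev2 x y P"
  using ev2_add[of x y P "- P"] by (simp add: eq_neg_iff_add_eq_0 add.commute)

lemma ev2_diff: "ev2 x y (P - Q) = ev2 x y P - ev2 x y Q"
  using ev2_add[of x y P "- Q"] by (simp add: ev2_minus)

lemma ev2_super_sign: "ev2 x y (super_sign k P) = super_sign k (ev2 x y P)"
  by (simp add: super_sign_def ev2_minus)

lemma ev2_sum: "ev2 x y (sum h A) = (\<Sum>n\<in>A. ev2 x y (h n))"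
  by (induction A rule: infinite_finite_induct) (auto simp: ev2_add)

lemma ev_const [simp]: "ev z [:c:] = c"
  by (simp add: ev_def)

lemma ev2_const [simp]: "ev2 x y [:p:] = ev y p"
  by (simp add: ev2_def)

lemma ev_pCons: "ev z (pCons c p) = c + scl z (ev z p)"
proof -
  have "ev z (pCons c p) = (\<Sum>n\<le>Suc (degree p). scl (z ^ n) (coeff (pCons c p) n))"
    by (rule ev_eq_sum) (simp add: degree_pCons_le)
  also have "\<dots> = c + (\<Sum>n\<le>degree p. scl (z ^ Suc n) (coeff p n))"
    by (simp add: sum.atMost_Suc_shift del: sum.atMost_Suc)
  finally show ?thesis
    by (simp add: ev_def scale_sum_right)
qed

lemma ev2_pCons: "ev2 x y (pCons p P) = ev y p + scl x (ev2 x y P)"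
proof -
  have "ev2 x y (pCons p P) = (\<Sum>n\<le>Suc (degree P). scl (x ^ n) (ev y (coeff (pCons p P) n)))"
    by (rule ev2_eq_sum) (simp add: degree_pCons_le)
  also have "\<dots> = ev y p + (\<Sum>n\<le>degree P. scl (x ^ Suc n) (ev y (coeff P n)))"
    by (simp add: sum.atMost_Suc_shift del: sum.atMost_Suc)
  finally show ?thesis
    by (simp add: ev2_def scale_sum_right)
qed

lemma ev_map_poly: "linear_op L \<Longrightarrow> ev z (map_poly L p) = L (ev z p)"
  by (induction p)
    (simp_all add: map_poly_pCons linear_op_0 ev_pCons linear_op_add linear_op_scl)

lemma linear_op_scl_self: "linear_op (scl c)"
  by (rule linear_opI) (simp_all add: scale_right_distrib mult.commute)

lemma linear_op_ev:
  assumes "linear_poly F"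
  shows "linear_op (\<lambda>a. ev z (F a))"
proof -
  interpret F: Vector_Spaces.linear scl "\<lambda>c. map_poly (scl c)" F by fact
  show ?thesis
    by (rule linear_opI)
      (simp_all add: F.add F.scale ev_add ev_map_poly linear_op_scl_self)
qed

lemma ev2_map_poly_map_poly:
  "linear_op L \<Longrightarrow> ev2 x y (map_poly (map_poly L) P) = L (ev2 x y P)"
  by (induction P)
    (simp_all add: map_poly_pCons linear_op_0 ev2_pCons linear_op_add linear_op_scl ev_map_poly)

section \<open>Formal substitutions as multiplication by scalars\<close>

lemma ev2_lam: "ev2 x y (lam P) = scl x (ev2 x y P)"
  by (simp add: lam_def ev2_pCons)

lemma ev2_mu: "ev2 x y (mu P) = scl y (ev2 x y P)"
  by (induction P)
    (simp_all add: mu_def map_poly_pCons ev2_pCons ev_pCons scale_right_distrib mult.commute)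

lemma ev2_lam_mu: "ev2 x y ((lam + mu) P) = scl (x + y) (ev2 x y P)"
  by (simp add: ev2_add ev2_lam ev2_mu scale_left_distrib)

lemma ev2_mu_lam: "ev2 x y ((mu - lam) P) = scl (y - x) (ev2 x y P)"
  by (simp add: ev2_diff ev2_lam ev2_mu scale_left_diff_distrib)

text \<open>An expression to be substituted is an operator \<open>T\<close>. After evaluation
  \<open>T\<close> is multiplication by a number \<open>w\<close>, so its iterates become powers of
  \<open>w\<close>.\<close>

lemma ev2_subst:
  assumes "\<And>P. ev2 x y (T P) = scl w (ev2 x y P)"
  shows "ev2 x y (subst T \<iota> p) = (\<Sum>n\<le>degree p. scl (w ^ n) (ev2 x y (\<iota> (coeff p n))))"
proof -
  have "ev2 x y ((T ^^ n) P) = scl (w ^ n) (ev2 x y P)" for n P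
    by (induction n) (simp_all add: assms)
  then show ?thesis
    by (simp add: subst_def ev2_sum)
qed

text \<open>The bridge from formal variables to numbers: all uses of \<open>apply_at\<close> in the
  bracket and in the centroid conditions are read through it. Linearity of \<open>F\<close> moves
  the finite sum over powers of \<open>w\<close> into its argument.\<close>

lemma ev2_apply_at:
  assumes V: "\<And>P. ev2 x y (V P) = scl v (ev2 x y P)"
    and W: "\<And>P. ev2 x y (W P) = scl w (ev2 x y P)"
    and F: "linear_poly F"
  shows "ev2 x y (apply_at V F W p) = ev v (F (ev w p))"
proof -
  have "ev2 x y (at_var V q) = ev v q" for q
    by (simp add: at_var_def ev2_subst[OF V] ev_def)
  then show ?thesis
    by (simp add: apply_at_def ev2_subst[OF W] ev_def[of w p]
        linear_op_sum[OF linear_op_ev[OF F]] linear_op_scl[OF linear_op_ev[OF F]])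
qed

text \<open>
  If \<open>p(z) = \<Sum>n\<le>N. z^n c\<^sub>n\<close>, then \<open>p(2z) - 2^N p(z)\<close> has lower degree, with coefficients
  \<open>(2^n - 2^N) c\<^sub>n\<close>.
\<close>

lemma coeffs_in_subspace:
  assumes "subspace S" "\<And>z. (\<Sum>n\<le>N. scl (z ^ n) (c n)) \<in> S" "n \<le> N"
  shows "c n \<in> S"
  using assms(2,3)
proof (induction N arbitrary: c n)
  case 0
  then show ?case using 0(1)[of 1] by simp
next
  case (Suc N)
  let ?d = "\<lambda>n. scl (2 ^ n - 2 ^ Suc N) (c n)"
  have d: "scl (z ^ n) (?d n) = scl ((2 * z) ^ n) (c n) - scl (2 ^ Suc N) (scl (z ^ n) (c n))" for z n
    unfolding scale_scale scale_left_diff_distrib[symmetric]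
    by (simp add: power_mult_distrib algebra_simps)
  have top: "scl ((2 * z) ^ Suc N) (c (Suc N)) = scl (2 ^ Suc N) (scl (z ^ Suc N) (c (Suc N)))" for z
    by (simp only: power_mult_distrib scale_scale)
  have "(\<Sum>n\<le>N. scl (z ^ n) (?d n))
      = (\<Sum>n\<le>N. scl ((2 * z) ^ n) (c n)) - scl (2 ^ Suc N) (\<Sum>n\<le>N. scl (z ^ n) (c n))" for z
    unfolding d sum_subtractf scale_sum_right ..
  moreover have "(\<Sum>n\<le>N. scl ((2 * z) ^ n) (c n)) - scl (2 ^ Suc N) (\<Sum>n\<le>N. scl (z ^ n) (c n))
      = (\<Sum>n\<le>Suc N. scl ((2 * z) ^ n) (c n))
      - scl (2 ^ Suc N) (\<Sum>n\<le>Suc N. scl (z ^ n) (c n))" for z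
    unfolding sum.atMost_Suc scale_right_distrib top add_diff_cancel_right ..
  ultimately have "(\<Sum>n\<le>N. scl (z ^ n) (?d n))
      = (\<Sum>n\<le>Suc N. scl ((2 * z) ^ n) (c n)) - scl (2 ^ Suc N) (\<Sum>n\<le>Suc N. scl (z ^ n) (c n))" for z
    by (rule trans)
  then have "(\<Sum>n\<le>N. scl (z ^ n) (?d n)) \<in> S" for z
    using subspace_diff[OF assms(1) Suc.prems(1) subspace_scale[OF assms(1) Suc.prems(1)]] by presburger
  from Suc.IH[OF this] have d: "?d n \<in> S" if "n \<le> N" for n
    using that by blast
  have low: "c n \<in> S" if "n \<le> N" for n
  proof -
    \<comment> \<open>The factor in \<open>?d n\<close> has to be inverted. Powers of 2 with
      different exponents differ in the natural numbers, and characteristic 0 preserves this in the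
      field.\<close>
    have "(2::nat) ^ n \<noteq> 2 ^ Suc N"
      using that by (simp add: power_inject_exp del: power_Suc)
    then have "(2::'k) ^ n - 2 ^ Suc N \<noteq> 0"
      by (metis eq_iff_diff_eq_0 of_nat_eq_iff of_nat_numeral of_nat_power)
    then show ?thesis
      using subspace_scale[OF assms(1) d[OF that], of "inverse (2 ^ n - 2 ^ Suc N)"] by simp
  qed
  \<comment> \<open>The passage to \<open>?d\<close> loses the top coefficient. The value at 1 is
    the sum of all coefficients, so the top one is recovered by subtracting the others.\<close>
  have "(\<Sum>n\<le>N. c n) + c (Suc N) \<in> S"
    using Suc.prems(1)[of 1] by simp
  moreover have "(\<Sum>n\<le>N. c n) \<in> S"
    using low assms(1) by (auto intro: subspace_sum)
  ultimately have "c (Suc N) \<in> S"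
    by (metis add_diff_cancel_left' assms(1) subspace_diff)
  with low Suc.prems(2) show ?case
    by (metis le_Suc_eq)
qed

lemma coeff_in_subspace:
  assumes "subspace S" "\<And>z. ev z p \<in> S"
  shows "coeff p n \<in> S"
proof (cases "n \<le> degree p")
  case True
  then show ?thesis
    using coeffs_in_subspace[where N = "degree p" and c = "coeff p"] assms by (simp add: ev_def)
qed (simp add: coeff_eq_0 subspace_0 assms)

text \<open>One variable at a time: for fixed \<open>y\<close> the powers of \<open>x\<close> are
  separated first, then those of \<open>y\<close>.\<close>

lemma coeff2_in_subspace:
  assumes "subspace S" "\<And>x y. ev2 x y P \<in> S"
  shows "coeff (coeff P m) n \<in> S"
proof (rule coeff_in_subspace[OF assms(1)])
  fix y
  show "ev y (coeff P m) \<in> S"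
  proof (cases "m \<le> degree P")
    case True
    then show ?thesis
      using coeffs_in_subspace[where N = "degree P" and c = "\<lambda>m. ev y (coeff P m)"] assms
      by (simp add: ev2_def)
  qed (simp add: coeff_eq_0 subspace_0 assms)
qed

text \<open>The values of \<open>P - Q\<close> lie in the subspace \<open>{0}\<close>, hence so do
  its coefficients. Identities in \<lambda> and \<mu> can therefore be checked on numbers.\<close>

lemma ev2_inject:
  assumes "\<And>x y. ev2 x y P = ev2 x y Q"
  shows "P = Q"
proof -
  have "coeff (coeff (P - Q) m) n \<in> {0}" for m n
    by (rule coeff2_in_subspace) (simp_all add: ev2_diff assms)
  then show ?thesis
    by (intro poly_eqI) simp
qed

lemma ev_in_subspace: "subspace S \<Longrightarrow> (\<And>n. coeff p n \<in> S) \<Longrightarrow> ev z p \<in> S"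
  unfolding ev_def by (intro subspace_sum subspace_scale)

end

section \<open>Conformal maps and their bracket, with \<complex> acting by constant
  polynomials\<close>

sublocale graded_module \<subseteq> C: poly_space "\<lambda>c. scale [:c:]"
  by unfold_locales
    (simp_all add: scale_right_distrib scale_left_distrib[symmetric] one_pCons[symmetric] mult.commute)

context graded_module
begin

lemma linear_op_del: "C.linear_op (del scale)"
  unfolding del_def by (rule C.linear_opI) (simp_all add: scale_right_distrib mult.commute)

lemma C_subspace_R: "C.subspace (R i)"
  using subspace_R[of i] by (simp add: subspace_def C.subspace_def)

lemma Cend_linear: "f \<in> Cend_deg scale R i \<Longrightarrow> C.linear_poly f"
  by (simp add: Chom_deg_def clinear_poly_def)

lemma Cend_ev_linear: "f \<in> Cend_deg scale R i \<Longrightarrow> C.linear_op (\<lambda>a. C.ev x (f a))"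
  by (rule C.linear_op_ev[OF Cend_linear])

lemma Cend_ev_del:
  assumes "f \<in> Cend_deg scale R i"
  shows "C.ev x (f (del scale a)) = del scale (C.ev x (f a)) + scale [:x:] (C.ev x (f a))"
proof -
  have "f (del scale a) = map_poly (del scale) (f a) + pCons 0 (f a)"
    using assms by (simp add: Chom_deg_def)
  then show ?thesis
    by (simp add: C.ev_add C.ev_pCons C.ev_map_poly linear_op_del)
qed

lemma Cend_ev_grading: "f \<in> Cend_deg scale R i \<Longrightarrow> a \<in> R k \<Longrightarrow> C.ev x (f a) \<in> R (k + i)"
  by (rule C.ev_in_subspace[OF C_subspace_R]) (simp add: Chom_deg_def)

lemma homogeneous_decomp: obtains a0 a1 where "a = a0 + a1" "a0 \<in> R 0" "a1 \<in> R 1"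
  using R_sum unfolding graded_sum_def by blast

text \<open>At \<lambda> = \<open>x\<close> and \<mu> = \<open>y\<close> the bracket is an ordinary
  supercommutator of two linear operators on the module, with \<open>g\<close> taken at
  \<open>y - x\<close>.\<close>

lemma ev2_bracket_hom:
  assumes "f \<in> Cend_deg scale R i" "g \<in> Cend_deg scale R j"
  shows "C.ev2 x y (Cend_bracket_hom i j f g a)
    = C.ev x (f (C.ev (y - x) (g a))) - super_sign (i * j) (C.ev (y - x) (g (C.ev x (f a))))"
  by (simp add: Cend_bracket_hom_def C.ev2_diff C.ev2_super_sign
      C.ev2_apply_at[OF C.ev2_lam C.ev2_mu_lam Cend_linear[OF assms(1)]]
      C.ev2_apply_at[OF C.ev2_mu_lam C.ev2_lam Cend_linear[OF assms(2)]])

lemma bracket_hom_add: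
  assumes "f \<in> Cend_deg scale R i" "g \<in> Cend_deg scale R j"
  shows "Cend_bracket_hom i j f g (a + b) = Cend_bracket_hom i j f g a + Cend_bracket_hom i j f g b"
  by (rule C.ev2_inject)
    (simp add: ev2_bracket_hom[OF assms] C.ev2_add C.linear_op_add[OF Cend_ev_linear[OF assms(1)]]
      C.linear_op_add[OF Cend_ev_linear[OF assms(2)]] super_sign_def)

lemma bracket_hom_scale:
  assumes "f \<in> Cend_deg scale R i" "g \<in> Cend_deg scale R j"
  shows "Cend_bracket_hom i j f g (scale [:c:] a)
    = map_poly (map_poly (scale [:c:])) (Cend_bracket_hom i j f g a)"
  by (rule C.ev2_inject)
    (simp add: ev2_bracket_hom[OF assms] C.ev2_map_poly_map_poly C.linear_op_scl_self
      C.linear_op_scl[OF Cend_ev_linear[OF assms(1)]] C.linear_op_scl[OF Cend_ev_linear[OF assms(2)]]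
      C.linear_op_super_sign[OF C.linear_op_scl_self, symmetric] scale_right_diff_distrib)

lemma bracket_hom_del:
  assumes "f \<in> Cend_deg scale R i" "g \<in> Cend_deg scale R j"
  shows "Cend_bracket_hom i j f g (del scale a)
    = map_poly (map_poly (del scale)) (Cend_bracket_hom i j f g a) + mu (Cend_bracket_hom i j f g a)"
proof (rule C.ev2_inject)
  fix x y
  let ?f = "\<lambda>a. C.ev x (f a)" and ?g = "\<lambda>a. C.ev (y - x) (g a)"
  have f: "?f (del scale a) = del scale (?f a) + scale [:x:] (?f a)"
      "?f (scale [:c:] a) = scale [:c:] (?f a)" "?f (a + b) = ?f a + ?f b" for a b c
    using Cend_ev_del[OF assms(1)] C.linear_op_scl[OF Cend_ev_linear[OF assms(1)]]
      C.linear_op_add[OF Cend_ev_linear[OF assms(1)]] by blast+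
  have g: "?g (del scale a) = del scale (?g a) + scale [:y - x:] (?g a)"
      "?g (scale [:c:] a) = scale [:c:] (?g a)" "?g (a + b) = ?g a + ?g b" for a b c
    using Cend_ev_del[OF assms(2)] C.linear_op_scl[OF Cend_ev_linear[OF assms(2)]]
      C.linear_op_add[OF Cend_ev_linear[OF assms(2)]] by blast+
  \<comment> \<open>Moving \<partial> past \<open>f\<close> contributes \<open>x\<close> and past
    \<open>g\<close> contributes \<open>y - x\<close>. In either order of composition the total is
    \<open>y\<close>, the value of \<mu>.\<close>
  have xy: "scale [:x:] v + scale [:y - x:] v = scale [:y:] v" for v
    using C.scale_left_distrib[of x "y - x" v] by simp
  have "?f (?g (del scale a)) = del scale (?f (?g a)) + scale [:y:] (?f (?g a))"
    by (simp only: f g add.assoc xy)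
  moreover have "?g (?f (del scale a)) = del scale (?g (?f a)) + scale [:y:] (?g (?f a))"
    by (simp only: f g add.assoc add.commute[of "scale [:y - x:] _"] xy)
  ultimately show "C.ev2 x y (Cend_bracket_hom i j f g (del scale a)) =
      C.ev2 x y (map_poly (map_poly (del scale)) (Cend_bracket_hom i j f g a)
        + mu (Cend_bracket_hom i j f g a))"
    by (simp add: C.ev2_add C.ev2_mu C.ev2_map_poly_map_poly linear_op_del ev2_bracket_hom[OF assms]
        C.linear_op_diff[OF linear_op_del] C.linear_op_super_sign[OF linear_op_del]
        scale_right_diff_distrib C.linear_op_super_sign[OF C.linear_op_scl_self])
      (simp add: super_sign_def)
qed

text \<open>Values of the bracket on homogeneous arguments lie in \<open>S\<close> by
  \<open>H\<close> and have the right degree, so the coefficients inherit both properties.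
  \<open>S\<close> will be the center.\<close>

lemma coeff_bracket_hom_in_Chom_deg:
  assumes f: "f \<in> Cend_deg scale R i" and g: "g \<in> Cend_deg scale R j"
    and S: "C.subspace S"
    and H: "\<And>x y k a. a \<in> R k \<Longrightarrow> C.ev2 x y (Cend_bracket_hom i j f g a) \<in> S"
  shows "(\<lambda>a. coeff (Cend_bracket_hom i j f g a) n) \<in> Chom_deg scale R scale (\<lambda>k. S \<inter> R k) (i + j)"
proof -
  interpret F: Vector_Spaces.linear "\<lambda>c. scale [:c:]" "\<lambda>c. map_poly (scale [:c:])" f
    using Cend_linear[OF f] .
  have "clinear_poly scale scale (\<lambda>a. coeff (Cend_bracket_hom i j f g a) n)"
    unfolding clinear_poly_def Vector_Spaces.linear_def module_hom_def module_hom_axioms_def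
    using C.vector_space_axioms F.vs2.vector_space_axioms
    by (simp add: module_iff_vector_space bracket_hom_add[OF f g] bracket_hom_scale[OF f g]
        coeff_map_poly)
  moreover have "coeff (coeff (Cend_bracket_hom i j f g a) n) m \<in> S \<inter> R (k + (i + j))"
    if a: "a \<in> R k" for a k m
  proof (rule C.coeff2_in_subspace)
    show "C.subspace (S \<inter> R (k + (i + j)))"
      using S C_subspace_R by (rule C.subspace_inter)
    fix x y
    have "C.ev x (f (C.ev (y - x) (g a))) \<in> R (k + (i + j))"
      using Cend_ev_grading[OF f Cend_ev_grading[OF g a]] by (simp only: ac_simps)
    moreover have "C.ev (y - x) (g (C.ev x (f a))) \<in> R (k + (i + j))"
      using Cend_ev_grading[OF g Cend_ev_grading[OF f a]] by (simp only: ac_simps)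
    ultimately show "C.ev2 x y (Cend_bracket_hom i j f g a) \<in> S \<inter> R (k + (i + j))"
      using H[OF a] unfolding ev2_bracket_hom[OF f g] super_sign_def
      by (auto intro!: C.subspace_diff C.subspace_add C_subspace_R)
  qed
  \<comment> \<open>\<open>mu\<close> acts inside each \<lambda>-coefficient, so
    \<open>bracket_hom_del\<close> gives the conformal rule for each coefficient separately.\<close>
  ultimately show ?thesis
    by (simp add: Chom_deg_def bracket_hom_del[OF f g] mu_def coeff_map_poly)
qed

text \<open>
  The \<open>\<lambda>\<close>-degree of \<open>[f\<^sub>\<lambda> g]\<^sub>\<mu>(a)\<close> does not grow when \<open>\<partial>\<close> is applied to \<open>a\<close>, so it is bounded by
  its maximum on a finite set of generators.
\<close>

lemma MOST_coeff_bracket_hom: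
  assumes f: "f \<in> Cend_deg scale R i" and g: "g \<in> Cend_deg scale R j"
  shows "\<forall>\<^sub>\<infinity>n. \<forall>a. coeff (Cend_bracket_hom i j f g a) n = 0"
proof -
  let ?B = "Cend_bracket_hom i j f g"
  obtain A where A: "finite A" "span A = UNIV"
    using finitely_generated by blast
  \<comment> \<open>The inserted 0 keeps the set nonempty when there are no generators.\<close>
  define N where "N = Max (insert 0 ((\<lambda>a. degree (?B a)) ` A))"
  define D where "D = {a. \<forall>n>N. coeff (?B a) n = 0}"
  have "A \<subseteq> D"
  proof
    fix a assume "a \<in> A"
    then have "degree (?B a) \<le> N"
      using A(1) by (simp add: N_def)
    then show "a \<in> D"
      by (simp add: D_def coeff_eq_0)
  qed
  moreover have "subspace D"
  proof (rule subspaceI)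
    have "?B 0 = 0"
      using bracket_hom_add[OF f g, of 0 0] by simp
    then show zero: "0 \<in> D"
      by (simp add: D_def)
    show add: "a + b \<in> D" if "a \<in> D" "b \<in> D" for a b
      using that by (simp add: D_def bracket_hom_add[OF f g])
    have const: "scale [:c:] a \<in> D" if "a \<in> D" for a c
      using that by (simp add: D_def bracket_hom_scale[OF f g] coeff_map_poly)
    \<comment> \<open>\<open>mu\<close> only shifts within a \<lambda>-coefficient, so a coefficient
      that vanishes still vanishes after \<partial> is applied.\<close>
    have del: "del scale a \<in> D" if "a \<in> D" for a
      using that by (simp add: D_def bracket_hom_del[OF f g] coeff_map_poly mu_def
          C.linear_op_0[OF linear_op_del])
    show "scale p a \<in> D" if a: "a \<in> D" for p a
    proof (induction p)
      case 0
      then show ?case using zero by simp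
    next
      case (pCons c p)
      \<comment> \<open>Horner form: closure under complex scalars and \<partial> gives closure
        under all of \<complex>[\<partial>], as the span of the generators requires.\<close>
      have "pCons c p = [:c:] + [:0, 1:] * p"
        by simp
      then have "scale (pCons c p) a = scale [:c:] a + del scale (scale p a)"
        unfolding del_def by (metis scale_left_distrib scale_scale)
      then show ?case
        using add const[OF a] del[OF pCons.IH] by simp
    qed
  qed
  ultimately have "D = UNIV"
    using A(2) span_minimal by blast
  then show ?thesis
    unfolding MOST_nat D_def by blast
qed

section \<open>Homogeneous components and sums of conformal maps\<close>

lemma Cend_deg_unique:
  assumes "d \<in> Cend_deg scale R 0" "d' \<in> Cend_deg scale R 0" "e \<in> Cend_deg scale R 1"
    "e' \<in> Cend_deg scale R 1" "d + e = d' + e'"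
  shows "d = d'"
proof -
  have hom: "C.ev x (d a) = C.ev x (d' a)" if a: "a \<in> R k" for a k x
  proof -
    have "C.ev x (d a) + C.ev x (e a) = C.ev x (d' a) + C.ev x (e' a)"
      using assms(5) by (metis C.ev_add plus_fun_apply)
    \<comment> \<open>A difference of even parts equals a difference of odd parts, so on an argument
      of degree \<open>k\<close> its values have degree both \<open>k\<close> and
      \<open>k + 1\<close>. These are the two distinct degrees, and \<open>R_Int\<close> leaves only
      0.\<close>
    then have eq: "C.ev x (d a) - C.ev x (d' a) = C.ev x (e' a) - C.ev x (e a)"
      by (simp add: algebra_simps)
    have "C.ev x (d a) - C.ev x (d' a) \<in> R k"
      using Cend_ev_grading[OF assms(1) a] Cend_ev_grading[OF assms(2) a]
      unfolding add_0_right by (intro C.subspace_diff C_subspace_R)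
    moreover have "C.ev x (d a) - C.ev x (d' a) \<in> R (k + 1)"
      unfolding eq using Cend_ev_grading[OF assms(3) a] Cend_ev_grading[OF assms(4) a]
      by (intro C.subspace_diff C_subspace_R)
    ultimately have "C.ev x (d a) - C.ev x (d' a) \<in> R 0 \<inter> R 1"
      by (cases k) simp_all
    then show ?thesis
      using R_Int by simp
  qed
  show ?thesis
  proof
    fix a
    obtain a0 a1 where a: "a = a0 + a1" "a0 \<in> R 0" "a1 \<in> R 1"
      by (rule homogeneous_decomp)
    have "C.ev x (d a - d' a) \<in> {0}" for x
    proof -
      have "C.ev x (d a) = C.ev x (d' a)"
        using hom[OF a(2)] hom[OF a(3)] unfolding a(1)
          C.linear_op_add[OF Cend_ev_linear[OF assms(1)]]
          C.linear_op_add[OF Cend_ev_linear[OF assms(2)]] by simp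
      then show ?thesis
        using C.ev_add[of x "d a - d' a" "d' a"] by simp
    qed
    then have "coeff (d a - d' a) n \<in> {0}" for n
      by (rule C.coeff_in_subspace[rotated]) simp
    then show "d a = d' a"
      by (simp add: poly_eq_iff)
  qed
qed

text \<open>Uniqueness of the decomposition gives the definite description in
  \<open>component\<close> its intended value, so \<open>Cend_bracket\<close> can be computed from
  any homogeneous decomposition.\<close>

lemma component_Cend:
  assumes "d \<in> Cend_deg scale R 0" "e \<in> Cend_deg scale R 1"
  shows "component (Cend_deg scale R) 0 (d + e) = d" "component (Cend_deg scale R) 1 (d + e) = e"
proof -
  let ?u = "\<lambda>i::bit. if i = 0 then d else e"
  have "(THE u. (\<forall>j. u j \<in> Cend_deg scale R j) \<and> d + e = u 0 + u 1) = ?u"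
  proof (rule the_equality)
    show "(\<forall>j. ?u j \<in> Cend_deg scale R j) \<and> d + e = ?u 0 + ?u 1"
      using assms by simp
  next
    fix u :: "bit \<Rightarrow> 'r \<Rightarrow> 'r poly"
    assume u: "(\<forall>j. u j \<in> Cend_deg scale R j) \<and> d + e = u 0 + u 1"
    then have "d = u 0"
      using Cend_deg_unique[OF assms(1) _ assms(2)] by blast
    moreover from this u have "e = u 1"
      by (metis add_left_cancel)
    ultimately show "u = ?u"
      by auto
  qed
  then show "component (Cend_deg scale R) 0 (d + e) = d" "component (Cend_deg scale R) 1 (d + e) = e"
    by (simp_all add: component_def)
qed

text \<open>Needed because two of the four homogeneous brackets contribute to each total
  degree.\<close>

lemma Chom_deg_add:
  assumes "f \<in> Chom_deg scale R scale (\<lambda>k. S \<inter> R k) i" "g \<in> Chom_deg scale R scale (\<lambda>k. S \<inter> R k) i"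
    and "C.subspace S"
  shows "(\<lambda>a. f a + g a) \<in> Chom_deg scale R scale (\<lambda>k. S \<inter> R k) i"
proof -
  have lin: "C.linear_poly f" "C.linear_poly g"
    using assms by (simp_all add: Chom_deg_def clinear_poly_def)
  interpret f: Vector_Spaces.linear "\<lambda>c. scale [:c:]" "\<lambda>c. map_poly (scale [:c:])" f
    by fact
  have "C.linear_poly (\<lambda>a. f a + g a)"
    by (intro vector_space_pair.linear_compose_add vector_space_pair.intro
        C.vector_space_axioms f.vs2.vector_space_axioms lin)
  moreover have "map_poly (del scale) (p + q) = map_poly (del scale) p + map_poly (del scale) q" for p q
    by (simp add: poly_eq_iff coeff_map_poly C.linear_op_0[OF linear_op_del]
        C.linear_op_add[OF linear_op_del])
  ultimately show ?thesis
    using assms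
    by (simp add: Chom_deg_def clinear_poly_def C.subspace_add C_subspace_R)
qed

end

section \<open>Central values of the bracket of centroid and quasicentroid\<close>

context lie_conformal_superalgebra
begin

lemma br_linear_left: "C.linear_poly (\<lambda>a. br a b)"
  and br_linear_right: "C.linear_poly (br a)"
  using linear_left linear_right by (simp_all add: clinear_poly_def)

lemma center_iff: "a \<in> center br \<longleftrightarrow> (\<forall>z b. C.ev z (br a b) = 0)"
proof
  assume *: "\<forall>z b. C.ev z (br a b) = 0"
  have "coeff (br a b) n \<in> {0}" for b n
    by (rule C.coeff_in_subspace) (simp_all add: *)
  then show "a \<in> center br"
    by (simp add: center_def poly_eq_iff)
qed (simp add: center_def)

lemma C_subspace_center: "C.subspace (center br)"
  by (rule C.subspaceI)
    (simp_all add: center_iff C.linear_op_0[OF C.linear_op_ev[OF br_linear_left]]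
      C.linear_op_add[OF C.linear_op_ev[OF br_linear_left]]
      C.linear_op_scl[OF C.linear_op_ev[OF br_linear_left]])

text \<open>Only the outer two members of the centroid condition are compared: \<open>f\<close> is
  pulled out of the left slot of the bracket, without a sign.\<close>

lemma centroid_ev:
  assumes "f \<in> centroid_deg scale R br i" "a \<in> R k"
  shows "C.ev (x + y) (br (C.ev x (f a)) b) = C.ev x (f (C.ev y (br a b)))"
proof -
  have f: "f \<in> Cend_deg scale R i"
    and "apply_at (lam + mu) (\<lambda>d. br d b) lam (f a) = apply_at lam f mu (br a b)"
    using assms by (simp_all add: centroid_deg_def)
  then show ?thesis
    using C.ev2_apply_at[OF C.ev2_lam_mu C.ev2_lam br_linear_left, of x y b "f a"]
      C.ev2_apply_at[OF C.ev2_lam C.ev2_mu Cend_linear[OF f], of x y "br a b"] by metis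
qed

lemma quasicentroid_ev:
  assumes "g \<in> quasicentroid_deg scale R br j" "a \<in> R k"
  shows "C.ev (x + y) (br (C.ev x (g a)) b) = super_sign (j * k) (C.ev y (br a (C.ev x (g b))))"
proof -
  have "apply_at (lam + mu) (\<lambda>d. br d b) lam (g a)
      = super_sign (j * k) (apply_at mu (\<lambda>d. br a d) lam (g b))"
    using assms unfolding quasicentroid_deg_def by blast
  then show ?thesis
    using C.ev2_apply_at[OF C.ev2_lam_mu C.ev2_lam br_linear_left, of x y b "g a"]
      C.ev2_apply_at[OF C.ev2_mu C.ev2_lam br_linear_right, of x y a "g b"]
    by (metis C.ev2_super_sign)
qed

lemma ev2_bracket_in_center:
  assumes f: "f \<in> centroid_deg scale R br i" and g: "g \<in> quasicentroid_deg scale R br j"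
    and a: "a \<in> R k"
  shows "C.ev2 x y (Cend_bracket_hom i j f g a) \<in> center br"
  unfolding center_iff
proof (intro allI)
  fix z b
  have f': "f \<in> Cend_deg scale R i" and g': "g \<in> Cend_deg scale R j"
    using f g by (simp_all add: centroid_deg_def quasicentroid_deg_def)
  let ?f = "\<lambda>a. C.ev x (f a)" and ?g = "\<lambda>a. C.ev (y - x) (g a)"
  \<comment> \<open>Here \<mu> - \<lambda> takes the value \<open>y - x\<close>, and the bracket
    parameter splits as \<open>z = x + (y - x) + (z - y)\<close>. The three summands are the
    parameters carried by \<open>f\<close>, by \<open>g\<close> and by the innermost
    bracket.\<close>
  have "C.ev z (br (?f (?g a)) b) = ?f (C.ev ((y - x) + (z - y)) (br (?g a) b))"
    using centroid_ev[OF f Cend_ev_grading[OF g' a], of x "z - x" "y - x" b] by simp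
  also have "\<dots> = super_sign (j * k) (?f (C.ev (z - y) (br a (?g b))))"
    unfolding quasicentroid_ev[OF g a] by (rule C.linear_op_super_sign[OF Cend_ev_linear[OF f']])
  also have "\<dots> = super_sign (j * k) (C.ev (x + (z - y)) (br (?f a) (?g b)))"
    by (simp add: centroid_ev[OF f a])
  \<comment> \<open>Modulo 2, \<open>j * k = i * j + j * (k + i)\<close>. The second sign is the one
    that \<open>g\<close> produces when it passes the value of \<open>f\<close> at \<open>a\<close>,
    which has degree \<open>k + i\<close>.\<close>
  also have "\<dots> = super_sign (i * j) (super_sign (j * (k + i)) (C.ev (x + (z - y)) (br (?f a) (?g b))))"
    by (cases i; cases j; cases k) (simp_all add: super_sign_def)
  also have "\<dots> = super_sign (i * j) (C.ev z (br (?g (?f a)) b))"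
    using quasicentroid_ev[OF g Cend_ev_grading[OF f' a], of "y - x" "x + (z - y)" x b] by simp
  finally show "C.ev z (br (C.ev2 x y (Cend_bracket_hom i j f g a)) b) = 0"
    by (simp add: ev2_bracket_hom[OF f' g'] C.linear_op_diff[OF C.linear_op_ev[OF br_linear_left]]
        C.linear_op_super_sign[OF C.linear_op_ev[OF br_linear_left]])
qed

lemma Cend_bracket_in_Chom_center:
  assumes "f \<in> centroid scale R br" "g \<in> quasicentroid scale R br"
  shows "Cend_bracket scale R f g \<in> polys_over (Chom scale R scale (\<lambda>i. center br \<inter> R i))"
proof -
  obtain f0 f1 where f: "f = f0 + f1" "f0 \<in> centroid_deg scale R br 0" "f1 \<in> centroid_deg scale R br 1"
    using assms(1) by (auto simp: centroid_def graded_sum_def)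
  obtain g0 g1 where g: "g = g0 + g1" "g0 \<in> quasicentroid_deg scale R br 0"
      "g1 \<in> quasicentroid_deg scale R br 1"
    using assms(2) by (auto simp: quasicentroid_def graded_sum_def)
  have f': "f0 \<in> Cend_deg scale R 0" "f1 \<in> Cend_deg scale R 1"
    and g': "g0 \<in> Cend_deg scale R 0" "g1 \<in> Cend_deg scale R 1"
    using f g by (simp_all add: centroid_deg_def quasicentroid_deg_def)
  define h where "h i j n a = coeff (Cend_bracket_hom i j (if i = 0 then f0 else f1)
      (if j = 0 then g0 else g1) a) n" for i j :: bit and n a
  \<comment> \<open>The four brackets are grouped by total degree: equal degrees of \<open>f\<close>
    and \<open>g\<close> give an even map, since 1 + 1 = 0, and different degrees an odd
    one.\<close>
  have bracket: "Cend_bracket scale R f g n a = (h 0 0 n a + h 1 1 n a) + (h 0 1 n a + h 1 0 n a)" for n a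
    unfolding Cend_bracket_def h_def f(1) g(1)
    by (simp add: component_Cend[OF f'] component_Cend[OF g'] algebra_simps)
  have h: "h i j n \<in> Chom_deg scale R scale (\<lambda>k. center br \<inter> R k) (i + j)" for i j n
    unfolding h_def using f f' g g'
    by (intro coeff_bracket_hom_in_Chom_deg C_subspace_center ev2_bracket_in_center)
      auto
  have "Cend_bracket scale R f g n \<in> Chom scale R scale (\<lambda>i. center br \<inter> R i)" for n
  proof -
    have "Cend_bracket scale R f g n
        = (\<lambda>a. h 0 0 n a + h 1 1 n a) + (\<lambda>a. h 0 1 n a + h 1 0 n a)"
      by (simp add: fun_eq_iff bracket)
    moreover have "(\<lambda>a. h 0 0 n a + h 1 1 n a) \<in> Chom_deg scale R scale (\<lambda>k. center br \<inter> R k) 0"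
      using h[of 0 0] h[of 1 1] by (intro Chom_deg_add C_subspace_center) simp_all
    moreover have "(\<lambda>a. h 0 1 n a + h 1 0 n a) \<in> Chom_deg scale R scale (\<lambda>k. center br \<inter> R k) 1"
      using h[of 0 1] h[of 1 0] by (intro Chom_deg_add C_subspace_center) simp_all
    ultimately show ?thesis
      unfolding Chom_def graded_sum_def by blast
  qed
  moreover have "\<forall>\<^sub>\<infinity>n. Cend_bracket scale R f g n = 0"
  proof -
    have "\<forall>\<^sub>\<infinity>n. \<forall>a. h i j n a = 0" for i j
      unfolding h_def using f' g' by (intro MOST_coeff_bracket_hom) auto
    \<comment> \<open>Each of the four brackets vanishes from some power of \<lambda> on, uniformly
      in \<open>a\<close>, hence so does their sum.\<close>
    from this[of 0 0] this[of 1 1] this[of 0 1] this[of 1 0] show ?thesis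
      by eventually_elim (simp add: fun_eq_iff bracket)
  qed
  ultimately show ?thesis
    by (simp add: polys_over_def)
qed

text \<open>A homogeneous map kills homogeneous vectors because its coefficients lie in
  \<open>{0}\<close>; additivity extends this to all vectors.\<close>

lemma Chom_zero:
  assumes "h \<in> Chom scale R scale (\<lambda>i. {0} \<inter> R i)"
  shows "h = 0"
proof -
  have zero: "d a = 0" if d: "d \<in> Chom_deg scale R scale (\<lambda>i. {0} \<inter> R i) \<theta>" for d \<theta> a
  proof -
    interpret d: Vector_Spaces.linear "\<lambda>c. scale [:c:]" "\<lambda>c. map_poly (scale [:c:])" d
      using d by (simp add: Chom_deg_def clinear_poly_def)
    have "d a = 0" if "a \<in> R k" for a k
      using d that by (intro poly_eqI) (auto simp: Chom_deg_def)
    then show ?thesis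
      using homogeneous_decomp[of a] d.add by (metis add_0)
  qed
  obtain d e where "h = d + e" "d \<in> Chom_deg scale R scale (\<lambda>i. {0} \<inter> R i) 0"
      "e \<in> Chom_deg scale R scale (\<lambda>i. {0} \<inter> R i) 1"
    using assms unfolding Chom_def graded_sum_def by blast
  then show ?thesis
    by (simp add: fun_eq_iff zero del: Int_insert_left)
qed

end

theorem theorem4p5:
  fixes scale :: "complex poly \<Rightarrow> 'r::ab_group_add \<Rightarrow> 'r"
    and R :: "bit \<Rightarrow> 'r set"
    and br :: "'r \<Rightarrow> 'r \<Rightarrow> 'r poly"
  assumes "lie_conformal_superalgebra scale R br"
  shows "(\<forall>f\<in>centroid scale R br. \<forall>g\<in>quasicentroid scale R br.
            Cend_bracket scale R f g
              \<in> polys_over (Chom scale R scale (\<lambda>i. center br \<inter> R i)))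
       \<and> (center br = {0} \<longrightarrow>
            (\<forall>f\<in>centroid scale R br. \<forall>g\<in>quasicentroid scale R br.
               \<forall>n. Cend_bracket scale R f g n = 0))"
proof -
  interpret lie_conformal_superalgebra scale R br by fact
  \<comment> \<open>Membership in \<open>polys_over\<close> puts every coefficient of the bracket in
    \<open>Chom\<close> with central target. If the center is \<open>{0}\<close>,
    \<open>Chom_zero\<close> makes each coefficient vanish.\<close>
  show ?thesis
    using Cend_bracket_in_Chom_center Chom_zero by (fastforce simp: polys_over_def)
qed

end
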